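(* Consider the following eight-dimensional real Lie algebras on a basis $X_1,\dots,X_8$, with $[X_i,X_j]=\sum_kC_{ij}^kX_k$ and only nonzero $C_{ij}^k$ with $i<j$ listed. Let (A) denote $C_{23}^1=1,C_{12}^3=1,C_{13}^2=-1,C_{14}^7=\tfrac12,C_{15}^6=\tfrac12,C_{16}^5=-\tfrac12,C_{17}^4=-\tfrac12,C_{24}^5=\tfrac12,C_{25}^4=-\tfrac12,C_{26}^7=\tfrac12,C_{27}^6=-\tfrac12,C_{34}^6=\tfrac12,C_{35}^7=-\tfrac12,C_{36}^4=-\tfrac12,C_{37}^5=\tfrac12$; (B) denote $C_{12}^2=2,C_{13}^3=-2,C_{23}^1=1,C_{14}^4=1,C_{15}^5=-1,C_{25}^4=1,C_{34}^5=1,C_{16}^6=1,C_{17}^7=-1,C_{27}^6=1,C_{36}^7=1$. $L_{8,2}$: (A) and $C_{45}^8=1,C_{67}^8=-1$. $L_{8,4}^0$: (A) and $C_{48}^6=-1,C_{58}^7=-1,C_{68}^4=1,C_{78}^5=1$. $L_{8,5}$: $C_{23}^1=1,C_{12}^3=1,C_{13}^2=-1,C_{14}^7=\tfrac12,C_{15}^6=-\tfrac12,C_{16}^5=2,C_{16}^8=-1,C_{17}^4=-2,C_{18}^6=3,C_{24}^6=\tfrac12,C_{25}^7=\tfrac12,C_{26}^4=-2,C_{27}^5=-2,C_{27}^8=-1,C_{28}^7=3,C_{34}^5=2,C_{35}^4=-2,C_{36}^7=1,C_{37}^6=-1$. $L_{8,13}^{\varepsilon}$ ($\varepsilon=\pm1$):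 (B) and $C_{45}^8=1,C_{67}^8=\varepsilon$. $L_{8,14}$: (B) and $C_{68}^4=1,C_{78}^5=1$. $L_{8,15}$: (B) and $C_{67}^8=1,C_{68}^4=1,C_{78}^5=1$. $L_{8,17}^{-1}$: (B) and $C_{48}^4=1,C_{58}^5=1,C_{68}^6=-1,C_{78}^7=-1$. $L_{8,18}^0$: (B) and $C_{48}^6=-1,C_{58}^7=-1,C_{68}^4=1,C_{78}^5=1$. $L_{8,21}$: $C_{12}^2=2,C_{13}^3=-2,C_{23}^1=1,C_{14}^4=4,C_{15}^5=2,C_{17}^7=-2,C_{18}^8=-4,C_{25}^4=4,C_{26}^5=3,C_{27}^6=2,C_{28}^7=1,C_{34}^5=1,C_{35}^6=2,C_{36}^7=3,C_{37}^8=4$. Then the indecomposable Lie algebras $L_{8,2},L_{8,4}^0,L_{8,5},L_{8,13}^{\varepsilon},L_{8,14},L_{8,15},L_{8,17}^{-1},L_{8,18}^0,L_{8,21}$ are all obtained as contractions of simple Lie algebras. More precisely: (i) $\mathfrak{su}(3)$ contracts onto $L_{8,2}$, $L_{8,4}^0$ and $L_{8,5}$; (ii) $\mathfrak{su}(2,1)$ contracts onto $L_{8,2}$, $L_{8,4}^0$, $L_{8,13}^1$, $L_{8,14}$, $L_{8,15}$, $L_{8,18}^0$ and $L_{8,21}$; (iii) $\mathfrak{sl}(3,\mathbb{R})$ contracts onto $L_{8,5}$, $L_{8,13}^{-1}$, $L_{8,14}$, $L_{8,15}$, $L_{8,17}^{-1}$ and $L_{8,21}$.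
   Context: All Lie algebras are over $\mathbb{R}$. Unlisted brackets $[X_i,X_j]$, $i<j$, are zero; the others follow by antisymmetry. Contraction: for a Lie algebra $(V,[\cdot,\cdot])$ and nonsingular linear maps $\Phi_t$, $t\in[1,\infty)$, if $[X,Y]_\infty=\lim_{t\to\infty}\Phi_t^{-1}[\Phi_tX,\Phi_tY]$ exists for all $X,Y$, any Lie algebra isomorphic to $(V,[\cdot,\cdot]_\infty)$ is a contraction of $(V,[\cdot,\cdot])$. $\mathfrak{su}(3)$, $\mathfrak{su}(2,1)$, $\mathfrak{sl}(3,\mathbb{R})$ are the real forms of the complex simple Lie algebra $\mathfrak{sl}(3,\mathbb{C})$. *)

theory Defs
  imports "HOL-Analysis.Analysis"
begin

text \<open>A Lie algebra is given by a carrier V (a real linear subspace of an ambient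
real normed vector space) together with a bracket. The bracket is the Lie bracket of V.\<close>

definition lie_isomorphic ::
  "'a::real_vector set \<Rightarrow> ('a \<Rightarrow> 'a \<Rightarrow> 'a) \<Rightarrow> 'b::real_vector set \<Rightarrow> ('b \<Rightarrow> 'b \<Rightarrow> 'b) \<Rightarrow> bool"
  where "lie_isomorphic V br W br' \<longleftrightarrow>
    (\<exists>f. linear f \<and> bij_betw f V W \<and>
         (\<forall>X\<in>V. \<forall>Y\<in>V. f (br X Y) = br' (f X) (f Y)))"

definition contracts_onto ::
  "'a::real_normed_vector set \<Rightarrow> ('a \<Rightarrow> 'a \<Rightarrow> 'a) \<Rightarrow> 'b::real_vector set \<Rightarrow> ('b \<Rightarrow> 'b \<Rightarrow> 'b) \<Rightarrow> bool"
  where "contracts_onto V br W br' \<longleftrightarrow>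
    (\<exists>(\<Phi>::real \<Rightarrow> 'a \<Rightarrow> 'a) br_inf.
       (\<forall>t\<ge>1. linear (\<Phi> t) \<and> bij_betw (\<Phi> t) V V) \<and>
       (\<forall>X\<in>V. \<forall>Y\<in>V.
          ((\<lambda>t. inv_into V (\<Phi> t) (br (\<Phi> t X) (\<Phi> t Y))) \<longlongrightarrow> br_inf X Y) at_top) \<and>
       lie_isomorphic V br_inf W br')"

definition commutator :: "'a::comm_ring_1^'n^'n \<Rightarrow> 'a^'n^'n \<Rightarrow> 'a^'n^'n"
  where "commutator A B = A ** B - B ** A"

definition mtrace :: "'a::comm_ring_1^'n^'n \<Rightarrow> 'a"
  where "mtrace A = (\<Sum>i\<in>UNIV. A $ i $ i)"

definition cadj :: "complex^3^3 \<Rightarrow> complex^3^3"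
  where "cadj A = (\<chi> i j. cnj (A $ j $ i))"

definition J21 :: "complex^3^3"
  where "J21 = (\<chi> i j. if i = j then (if i = 3 then -1 else 1) else 0)"

definition su3 :: "(complex^3^3) set"
  where "su3 = {A. cadj A = - A \<and> mtrace A = 0}"

definition su21 :: "(complex^3^3) set"
  where "su21 = {A. cadj A ** J21 + J21 ** A = 0 \<and> mtrace A = 0}"

definition sl3R :: "(real^3^3) set"
  where "sl3R = {A. mtrace A = 0}"

text \<open>A list of entries (i,j,k,c) means C_{ij}^k = c (listed for i<j);
  the remaining constants follow by antisymmetry C_{ji}^k = - C_{ij}^k,
  unlisted ones are zero. Indices range over 1..8.\<close>

definition sc :: "(nat \<times> nat \<times> nat \<times> real) list \<Rightarrow> nat \<Rightarrow> nat \<Rightarrow> nat \<Rightarrow> real"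
  where "sc l i j k = sum_list (map (\<lambda>(a,b,c,v).
            (if (a,b,c) = (i,j,k) then v else 0) - (if (b,a,c) = (i,j,k) then v else 0)) l)"

definition bX :: "nat \<Rightarrow> real^8"
  where "bX i = axis (of_nat (i - 1) :: 8) 1"

definition sc_bracket :: "(nat \<times> nat \<times> nat \<times> real) list \<Rightarrow> real^8 \<Rightarrow> real^8 \<Rightarrow> real^8"
  where "sc_bracket l X Y =
    (\<Sum>i=1..8. \<Sum>j=1..8. \<Sum>k=1..8.
       ((X \<bullet> bX i) * (Y \<bullet> bX j) * sc l i j k) *\<^sub>R bX k)"

definition listA :: "(nat \<times> nat \<times> nat \<times> real) list" where
  "listA = [(2,3,1,1), (1,2,3,1), (1,3,2,-1), (1,4,7,1/2), (1,5,6,1/2), (1,6,5,-1/2),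
            (1,7,4,-1/2), (2,4,5,1/2), (2,5,4,-1/2), (2,6,7,1/2), (2,7,6,-1/2),
            (3,4,6,1/2), (3,5,7,-1/2), (3,6,4,-1/2), (3,7,5,1/2)]"

definition listB :: "(nat \<times> nat \<times> nat \<times> real) list" where
  "listB = [(1,2,2,2), (1,3,3,-2), (2,3,1,1), (1,4,4,1), (1,5,5,-1), (2,5,4,1),
            (3,4,5,1), (1,6,6,1), (1,7,7,-1), (2,7,6,1), (3,6,7,1)]"

definition L8_2 where "L8_2 = sc_bracket (listA @ [(4,5,8,1), (6,7,8,-1)])"

definition L8_4_0 where
  "L8_4_0 = sc_bracket (listA @ [(4,8,6,-1), (5,8,7,-1), (6,8,4,1), (7,8,5,1)])"

definition L8_5 where
  "L8_5 = sc_bracket [(2,3,1,1), (1,2,3,1), (1,3,2,-1), (1,4,7,1/2), (1,5,6,-1/2),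
     (1,6,5,2), (1,6,8,-1), (1,7,4,-2), (1,8,6,3), (2,4,6,1/2), (2,5,7,1/2),
     (2,6,4,-2), (2,7,5,-2), (2,7,8,-1), (2,8,7,3), (3,4,5,2), (3,5,4,-2),
     (3,6,7,1), (3,7,6,-1)]"

definition L8_13 :: "real \<Rightarrow> real^8 \<Rightarrow> real^8 \<Rightarrow> real^8" where
  "L8_13 \<epsilon> = sc_bracket (listB @ [(4,5,8,1), (6,7,8,\<epsilon>)])"

definition L8_14 where "L8_14 = sc_bracket (listB @ [(6,8,4,1), (7,8,5,1)])"

definition L8_15 where "L8_15 = sc_bracket (listB @ [(6,7,8,1), (6,8,4,1), (7,8,5,1)])"

definition L8_17_m1 where
  "L8_17_m1 = sc_bracket (listB @ [(4,8,4,1), (5,8,5,1), (6,8,6,-1), (7,8,7,-1)])"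

definition L8_18_0 where
  "L8_18_0 = sc_bracket (listB @ [(4,8,6,-1), (5,8,7,-1), (6,8,4,1), (7,8,5,1)])"

definition L8_21 where
  "L8_21 = sc_bracket [(1,2,2,2), (1,3,3,-2), (2,3,1,1), (1,4,4,4), (1,5,5,2), (1,7,7,-2),
     (1,8,8,-4), (2,5,4,4), (2,6,5,3), (2,7,6,2), (2,8,7,1), (3,4,5,1), (3,5,6,2),
     (3,6,7,3), (3,7,8,4)]"

end

theory Submission
  imports Defs
begin

text \<open>Every contraction in the list is a generalised Inonu-Wigner contraction. In each simple
  algebra one fixes a basis whose first three vectors span the Levi factor of the target (a copy of
  \<open>su(2)\<close>, \<open>so(3)\<close>, \<open>sl(2)\<close> or \<open>so(2,1)\<close>) and whose other five vectors transform under it exactly as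
  in the target. Multiplying the basis vectors by powers \<open>t ^ (- n\<^sub>i)\<close> with \<open>n\<^sub>c \<le> n\<^sub>a + n\<^sub>b\<close> whenever
  \<open>C\<^sub>a\<^sub>b\<^sup>c\<close> is nonzero makes the structure constants converge: those with \<open>n\<^sub>c = n\<^sub>a + n\<^sub>b\<close> survive, all
  others vanish in the limit.\<close>

section \<open>Rescaling structure constants\<close>

lemma UNIV_8: "(UNIV :: 8 set) = {0, 1, 2, 3, 4, 5, 6, 7}"
proof (rule sym, rule card_subset_eq)
  show "card {0, 1, 2, 3, 4, 5, 6, 7 :: 8} = CARD(8)" by simp
qed auto

lemma forall_8:
  "(\<forall>i::8. P i) \<longleftrightarrow> P 0 \<and> P 1 \<and> P 2 \<and> P 3 \<and> P 4 \<and> P 5 \<and> P 6 \<and> P 7"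
proof -
  have "(\<forall>i::8. P i) \<longleftrightarrow> (\<forall>i\<in>{0, 1, 2, 3, 4, 5, 6, 7}. P i)"
    by (simp flip: UNIV_8)
  then show ?thesis by simp
qed

lemma inner_bX: "x \<bullet> bX i = x $ of_nat (i - 1)"
  by (simp add: bX_def inner_axis)

lemma nth_bX: "bX i $ j = (if j = of_nat (i - 1) then 1 else 0)"
  by (simp add: bX_def axis_def)

lemma atLeastAtMost_1_8: "{1..8::nat} = {1, 2, 3, 4, 5, 6, 7, 8}"
  by auto

lemma bX_inner_bX:
  assumes "i \<in> {1..8}" "j \<in> {1..8}"
  shows "bX i \<bullet> bX j = (if i = j then 1 else 0)"
  using assms unfolding atLeastAtMost_1_8 inner_bX by (auto simp: nth_bX)

lemma sum_bX_expansion: "(\<Sum>i=1..8. (x \<bullet> bX i) *\<^sub>R bX i) = x"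
  unfolding atLeastAtMost_1_8 inner_bX
  by (simp add: vec_eq_iff forall_8 nth_bX)

lemma sc_bracket_Nil: "sc_bracket [] x y = 0"
  by (simp add: sc_bracket_def sc_def)

lemma sc_Cons:
  "sc ((a, b, c, v) # l) i j k =
     (if (a, b, c) = (i, j, k) then v else 0) - (if (b, a, c) = (i, j, k) then v else 0) + sc l i j k"
  by (simp add: sc_def)

text \<open>Applied twice below, to a list entry and to its antisymmetric partner.\<close>

lemma sum_delta3:
  fixes f :: "nat \<Rightarrow> nat \<Rightarrow> real" and e :: "nat \<Rightarrow> 'a::real_vector"
  assumes "a \<in> S" "b \<in> S" "c \<in> S" "finite S"
  shows "(\<Sum>i\<in>S. \<Sum>j\<in>S. \<Sum>k\<in>S. (f i j * (if (a, b, c) = (i, j, k) then v else 0)) *\<^sub>R e k)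
    = (f a b * v) *\<^sub>R e c"
proof -
  have "(\<Sum>k\<in>S. (f i j * (if (a, b, c) = (i, j, k) then v else 0)) *\<^sub>R e k)
     = (if j = b then if i = a then (f a b * v) *\<^sub>R e c else 0 else 0)" for i j
  proof -
    \<comment> \<open>Nested conditionals let the sums collapse one index at a time.\<close>
    have "(\<Sum>k\<in>S. (f i j * (if (a, b, c) = (i, j, k) then v else 0)) *\<^sub>R e k)
      = (\<Sum>k\<in>S. if k = c then (if j = b then if i = a then (f a b * v) *\<^sub>R e k else 0 else 0) else 0)"
      by (rule sum.cong) auto
    then show ?thesis using assms by simp
  qed
  then show ?thesis using assms by simp
qed

text \<open>The bracket is additive in the list, so each entry adds one antisymmetrised term. This
  evaluates concrete brackets and drives the induction for the limit.\<close>

lemma sc_bracket_Cons: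
  assumes "a \<in> {1..8}" "b \<in> {1..8}" "c \<in> {1..8}"
  shows "sc_bracket ((a, b, c, v) # l) x y =
    (v * ((x \<bullet> bX a) * (y \<bullet> bX b) - (x \<bullet> bX b) * (y \<bullet> bX a))) *\<^sub>R bX c + sc_bracket l x y"
proof -
  have *: "sc_bracket ((a, b, c, v) # l) x y =
     (\<Sum>i=1..8. \<Sum>j=1..8. \<Sum>k=1..8.
       ((x \<bullet> bX i) * (y \<bullet> bX j) * (if (a, b, c) = (i, j, k) then v else 0)) *\<^sub>R bX k) -
     (\<Sum>i=1..8. \<Sum>j=1..8. \<Sum>k=1..8.
       ((x \<bullet> bX i) * (y \<bullet> bX j) * (if (b, a, c) = (i, j, k) then v else 0)) *\<^sub>R bX k) +
     sc_bracket l x y"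
    unfolding sc_bracket_def sum_subtractf[symmetric] sum.distrib[symmetric]
    by (intro sum.cong refl) (simp only: sc_Cons distrib_left right_diff_distrib
        scaleR_add_left scaleR_diff_left)
  show ?thesis
    unfolding * sum_delta3[OF assms finite_atLeastAtMost]
      sum_delta3[OF assms(2,1,3) finite_atLeastAtMost]
    by (simp add: algebra_simps)
qed

section \<open>Diagonal rescalings and their limits\<close>

definition coord_scale :: "(nat \<Rightarrow> real) \<Rightarrow> real^8 \<Rightarrow> real^8"
  where "coord_scale s x = (\<Sum>i=1..8. (s i * (x \<bullet> bX i)) *\<^sub>R bX i)"

lemma linear_coord_scale: "linear (coord_scale s)"
  unfolding coord_scale_def
  by (intro linearI)
    (simp_all add: inner_left_distrib algebra_simps sum.distrib scaleR_sum_right)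

lemma coord_scale_inner: "k \<in> {1..8} \<Longrightarrow> coord_scale s x \<bullet> bX k = s k * (x \<bullet> bX k)"
proof -
  assume k: "k \<in> {1..8}"
  have "coord_scale s x \<bullet> bX k = (\<Sum>i=1..8. if i = k then s i * (x \<bullet> bX i) else 0)"
    unfolding coord_scale_def inner_sum_left by (rule sum.cong) (use k in \<open>simp_all add: bX_inner_bX\<close>)
  then show ?thesis using k by simp
qed

lemma coord_scale_bX: "k \<in> {1..8} \<Longrightarrow> coord_scale s (bX k) = s k *\<^sub>R bX k"
proof -
  assume k: "k \<in> {1..8}"
  have "coord_scale s (bX k) = (\<Sum>i=1..8. if i = k then s i *\<^sub>R bX i else 0)"
    unfolding coord_scale_def by (rule sum.cong) (use k in \<open>simp_all add: bX_inner_bX\<close>)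
  then show ?thesis using k by simp
qed

lemma coord_scale_inverse:
  assumes "\<And>i. s i \<noteq> 0"
  shows "coord_scale s (coord_scale (\<lambda>i. inverse (s i)) x) = x"
    and "coord_scale (\<lambda>i. inverse (s i)) (coord_scale s x) = x"
proof -
  have "coord_scale s (coord_scale (\<lambda>i. inverse (s i)) x) = (\<Sum>i=1..8. (x \<bullet> bX i) *\<^sub>R bX i)"
    unfolding coord_scale_def[of s]
    by (rule sum.cong[OF refl], subst coord_scale_inner) (use assms in auto)
  then show "coord_scale s (coord_scale (\<lambda>i. inverse (s i)) x) = x"
    by (simp only: sum_bX_expansion)
  have "coord_scale (\<lambda>i. inverse (s i)) (coord_scale s x) = (\<Sum>i=1..8. (x \<bullet> bX i) *\<^sub>R bX i)"
    unfolding coord_scale_def[of "\<lambda>i. inverse (s i)"]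
    by (rule sum.cong[OF refl], subst coord_scale_inner) (use assms in auto)
  then show "coord_scale (\<lambda>i. inverse (s i)) (coord_scale s x) = x"
    by (simp only: sum_bX_expansion)
qed

text \<open>Rescaling the basis to \<open>d i * t ^ (- n i) * X\<^sub>i\<close> multiplies the structure constant
  \<open>C\<^sub>a\<^sub>b\<^sup>c\<close> by \<open>d a * d b / d c * t ^ (n c - n a - n b)\<close>; the following list collects the limits
  as \<open>t\<close> tends to infinity.\<close>

definition limit_constants ::
  "(nat \<Rightarrow> real) \<Rightarrow> (nat \<Rightarrow> nat) \<Rightarrow> (nat \<times> nat \<times> nat \<times> real) list \<Rightarrow> (nat \<times> nat \<times> nat \<times> real) list"
  where "limit_constants d n l =
    map (\<lambda>(a, b, c, v). (a, b, c, if n a + n b = n c then v * d a * d b / d c else 0)) l"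

text \<open>The inequality makes the exponent of \<open>t\<close> non-positive. The spans of basis
  vectors of bounded weight then form a filtration compatible with the bracket, whose associated
  graded bracket is, up to the factors \<open>d\<close>, the limit.\<close>

definition valid_weights :: "(nat \<Rightarrow> nat) \<Rightarrow> (nat \<times> nat \<times> nat \<times> real) list \<Rightarrow> bool"
  where "valid_weights n l \<longleftrightarrow>
    (\<forall>(a, b, c, v) \<in> set l. {a, b, c} \<subseteq> {1..8} \<and> n c \<le> n a + n b)"

text \<open>By additivity in the list each entry can be followed separately: it acquires a constant
  times a non-negative power of \<open>inverse t\<close>.\<close>

lemma tendsto_rescaled_sc_bracket:
  assumes "valid_weights n l" "\<And>i. d i \<noteq> 0"
  defines "s \<equiv> \<lambda>t i. d i * inverse t ^ n i"
  shows "((\<lambda>t::real. coord_scale (\<lambda>i. inverse (s t i))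
            (sc_bracket l (coord_scale (s t) x) (coord_scale (s t) y)))
          \<longlongrightarrow> sc_bracket (limit_constants d n l) x y) at_top"
  using assms(1)
proof (induction l)
  case Nil
  show ?case
    by (simp add: sc_bracket_Nil limit_constants_def linear_0[OF linear_coord_scale])
next
  case (Cons e l)
  obtain a b c v where e: "e = (a, b, c, v)" by (cases e)
  have abc: "a \<in> {1..8}" "b \<in> {1..8}" "c \<in> {1..8}" and le: "n c \<le> n a + n b"
    using Cons.prems by (auto simp: e valid_weights_def)
  define w where "w = (x \<bullet> bX a) * (y \<bullet> bX b) - (x \<bullet> bX b) * (y \<bullet> bX a)"
  have IH: "((\<lambda>t::real. coord_scale (\<lambda>i. inverse (s t i))
            (sc_bracket l (coord_scale (s t) x) (coord_scale (s t) y)))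
          \<longlongrightarrow> sc_bracket (limit_constants d n l) x y) at_top"
    using Cons by (simp add: valid_weights_def)
  have step: "coord_scale (\<lambda>i. inverse (s t i))
            (sc_bracket (e # l) (coord_scale (s t) x) (coord_scale (s t) y)) =
       (v * d a * d b / d c * inverse t ^ (n a + n b - n c) * w) *\<^sub>R bX c +
       coord_scale (\<lambda>i. inverse (s t i)) (sc_bracket l (coord_scale (s t) x) (coord_scale (s t) y))"
    if "t > 0" for t :: real
  proof -
    \<comment> \<open>Natural-number subtraction in the exponent is exact because of
      \<open>le\<close>.\<close>
    have pow: "inverse t ^ n a * inverse t ^ n b / inverse t ^ n c = inverse t ^ (n a + n b - n c)"
      using le that by (simp add: power_diff power_add)
    have "v * (s t a * (x \<bullet> bX a) * (s t b * (y \<bullet> bX b)) - s t b * (x \<bullet> bX b) * (s t a * (y \<bullet> bX a)))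
        * inverse (s t c)
      = v * d a * d b / d c * (inverse t ^ n a * inverse t ^ n b / inverse t ^ n c) * w"
      by (simp add: s_def w_def divide_inverse inverse_mult_distrib algebra_simps)
    then show ?thesis
      unfolding e sc_bracket_Cons[OF abc] linear_add[OF linear_coord_scale]
        linear_scale[OF linear_coord_scale] coord_scale_bX[OF abc(3)] coord_scale_inner[OF abc(1)]
        coord_scale_inner[OF abc(2)] pow scaleR_scaleR
      by (simp only:)
  qed
  have "((\<lambda>t::real. v * d a * d b / d c * inverse t ^ (n a + n b - n c) * w)
      \<longlongrightarrow> (if n a + n b = n c then v * d a * d b / d c else 0) * w) at_top"
  proof (cases "n a + n b = n c")
    case False
    then have "((\<lambda>t::real. inverse t ^ (n a + n b - n c)) \<longlongrightarrow> 0) at_top"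
      using le tendsto_power[OF tendsto_inverse_0_at_top[OF filterlim_ident], of "n a + n b - n c"]
      by (simp add: power_0_left split: if_splits)
    then have "((\<lambda>t::real. v * d a * d b / d c * inverse t ^ (n a + n b - n c) * w)
      \<longlongrightarrow> v * d a * d b / d c * 0 * w) at_top"
      by (intro tendsto_intros)
    then show ?thesis using False by simp
  qed simp
  then have "((\<lambda>t::real. (v * d a * d b / d c * inverse t ^ (n a + n b - n c) * w) *\<^sub>R bX c +
       coord_scale (\<lambda>i. inverse (s t i)) (sc_bracket l (coord_scale (s t) x) (coord_scale (s t) y)))
      \<longlongrightarrow> ((if n a + n b = n c then v * d a * d b / d c else 0) * w) *\<^sub>R bX c +
        sc_bracket (limit_constants d n l) x y) at_top"
    by (intro tendsto_add tendsto_scaleR tendsto_const IH)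
  also have "((if n a + n b = n c then v * d a * d b / d c else 0) * w) *\<^sub>R bX c +
        sc_bracket (limit_constants d n l) x y = sc_bracket (limit_constants d n (e # l)) x y"
    by (simp add: limit_constants_def e sc_bracket_Cons[OF abc] w_def)
  finally show ?case
    by (rule Lim_transform_eventually)
      (rule eventually_mono[OF eventually_gt_at_top[of 0]], rule step[symmetric])
qed

section \<open>From structure constants to contractions\<close>

definition has_structure_constants ::
  "'a::real_normed_vector set \<Rightarrow> ('a \<Rightarrow> 'a \<Rightarrow> 'a) \<Rightarrow> (nat \<times> nat \<times> nat \<times> real) list \<Rightarrow> bool"
  where "has_structure_constants V br l \<longleftrightarrow>
    (\<exists>(f :: real^8 \<Rightarrow> 'a) g. linear f \<and> linear g \<and> (\<forall>x. f x \<in> V) \<and>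
       (\<forall>x. g (f x) = x) \<and> (\<forall>A\<in>V. f (g A) = A) \<and>
       (\<forall>x y. br (f x) (f y) = f (sc_bracket l x y)))"

lemma has_structure_constantsI:
  fixes f :: "real^8 \<Rightarrow> 'a::real_normed_vector"
  assumes "linear f" "linear g" "\<And>x. f x \<in> V" "\<And>x. g (f x) = x" "\<And>A. A \<in> V \<Longrightarrow> f (g A) = A"
    "\<And>x y. br (f x) (f y) = f (sc_bracket l x y)"
  shows "has_structure_constants V br l"
  unfolding has_structure_constants_def using assms by blast

text \<open>Conjugating the diagonal rescalings by the coordinate map turns the limit of structure
  constants into a contraction. The factors \<open>d\<close> normalise the surviving
  constants.\<close>

lemma contracts_onto_if_limit_constants:
  fixes V :: "'a::real_normed_vector set"
  assumes "has_structure_constants V br l" "valid_weights n l" and d: "\<And>i. d i \<noteq> 0"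
    and br': "\<And>x y. sc_bracket (limit_constants d n l) x y = br' x y"
  shows "contracts_onto V br UNIV br'"
proof -
  obtain f :: "real^8 \<Rightarrow> 'a" and g where lin: "linear f" "linear g" and f: "\<And>x. f x \<in> V"
    and gf: "\<And>x. g (f x) = x" and fg: "\<And>A. A \<in> V \<Longrightarrow> f (g A) = A"
    and br: "\<And>x y. br (f x) (f y) = f (sc_bracket l x y)"
    using assms(1) unfolding has_structure_constants_def by metis
  define s where "s = (\<lambda>t i. d i * inverse t ^ n i)"
  let ?D = "\<lambda>t. coord_scale (s t)" and ?D' = "\<lambda>t. coord_scale (\<lambda>i. inverse (s t i))"
  \<comment> \<open>Passing through \<open>g\<close> makes \<open>\<Phi> t\<close> linear on the
    whole ambient space, while bijectivity is claimed on \<open>V\<close> only.\<close>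
  define \<Phi> where "\<Phi> t = f \<circ> ?D t \<circ> g" for t
  define br_inf where "br_inf X Y = f (br' (g X) (g Y))" for X Y
  have DD': "?D t (?D' t x) = x" "?D' t (?D t x) = x" if "t \<ge> 1" for t x
    using coord_scale_inverse[of "s t" x] that d by (auto simp: s_def)
  have bij: "bij_betw (\<Phi> t) V V" if "t \<ge> 1" for t
    by (rule bij_betwI[where g = "f \<circ> ?D' t \<circ> g"]) (auto simp: \<Phi>_def f gf fg DD' that)
  have inv: "inv_into V (\<Phi> t) (f z) = f (?D' t z)" if "t \<ge> 1" for t z
    using bij_betw_inv_into_left[OF bij[OF that], of "f (?D' t z)"]
    by (simp add: \<Phi>_def f gf DD' that)
  \<comment> \<open>A linear map out of the finite-dimensional \<open>real^8\<close> is continuous,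
    so limits in coordinates pass through \<open>f\<close>.\<close>
  have blf: "bounded_linear f"
    using lin(1) linear_conv_bounded_linear by blast
  have "((\<lambda>t. inv_into V (\<Phi> t) (br (\<Phi> t X) (\<Phi> t Y))) \<longlongrightarrow> br_inf X Y) at_top"
    for X Y
  proof -
    have "((\<lambda>t. f (?D' t (sc_bracket l (?D t (g X)) (?D t (g Y))))) \<longlongrightarrow> br_inf X Y) at_top"
      unfolding br_inf_def s_def br'[symmetric]
      by (intro bounded_linear.tendsto[OF blf] tendsto_rescaled_sc_bracket assms)
    then show ?thesis
      by (rule Lim_transform_eventually)
        (rule eventually_mono[OF eventually_ge_at_top[of 1]], simp add: inv[symmetric] \<Phi>_def br)
  qed
  moreover have "lie_isomorphic V br_inf UNIV br'"
    unfolding lie_isomorphic_def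
    by (intro exI[of _ g]) (auto simp: br_inf_def gf lin f fg intro!: bij_betwI[where g = f])
  moreover have "linear (\<Phi> t)" for t
    unfolding \<Phi>_def by (intro linear_compose lin linear_coord_scale)
  ultimately show ?thesis
    unfolding contracts_onto_def using bij by blast
qed


section \<open>Bases of the simple Lie algebras\<close>

text \<open>The index type \<open>8\<close> is arithmetic modulo 8, so the coordinate of \<open>X\<^sub>i\<close> is entry \<open>i - 1\<close>.\<close>

definition vec8 :: "real \<Rightarrow> real \<Rightarrow> real \<Rightarrow> real \<Rightarrow> real \<Rightarrow> real \<Rightarrow> real \<Rightarrow> real \<Rightarrow> real^8"
  where "vec8 a b c d e f g h = (\<chi> i. if i = 0 then a else if i = 1 then b else if i = 2 then c
    else if i = 3 then d else if i = 4 then e else if i = 5 then f else if i = 6 then g else h)"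

lemma vec8_nth [simp]:
  "vec8 a b c d e f g h $ 0 = a" "vec8 a b c d e f g h $ 1 = b"
  "vec8 a b c d e f g h $ 2 = c" "vec8 a b c d e f g h $ 3 = d"
  "vec8 a b c d e f g h $ 4 = e" "vec8 a b c d e f g h $ 5 = f"
  "vec8 a b c d e f g h $ 6 = g" "vec8 a b c d e f g h $ 7 = h"
  by (simp_all add: vec8_def)

lemmas entrywise = vec_eq_iff forall_3 forall_8 complex_eq_iff

lemmas sc_bracket_simps = sc_bracket_Cons sc_bracket_Nil inner_bX nth_bX

section \<open>Matrix entries and membership equations\<close>

lemma commutator_nth:
  fixes A B :: "'a::comm_ring_1^3^3"
  shows "commutator A B $ i $ j =
    A $ i $ 1 * B $ 1 $ j + A $ i $ 2 * B $ 2 $ j + A $ i $ 3 * B $ 3 $ j -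
    (B $ i $ 1 * A $ 1 $ j + B $ i $ 2 * A $ 2 $ j + B $ i $ 3 * A $ 3 $ j)"
  by (simp add: commutator_def matrix_matrix_mult_def sum_3)

lemma sl3R_iff: "A \<in> sl3R \<longleftrightarrow> A $ 3 $ 3 = - A $ 1 $ 1 - A $ 2 $ 2"
  by (auto simp: sl3R_def mtrace_def sum_3)

text \<open>The conditions become real-linear equations that determine the last diagonal entry and
  the lower triangle, leaving eight real parameters.\<close>

lemma su3_iff:
  "A \<in> su3 \<longleftrightarrow>
    Re (A $ 1 $ 1) = 0 \<and> Re (A $ 2 $ 2) = 0 \<and> Re (A $ 3 $ 3) = 0 \<and>
    Im (A $ 3 $ 3) = - Im (A $ 1 $ 1) - Im (A $ 2 $ 2) \<and>
    Re (A $ 2 $ 1) = - Re (A $ 1 $ 2) \<and> Im (A $ 2 $ 1) = Im (A $ 1 $ 2) \<and>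
    Re (A $ 3 $ 1) = - Re (A $ 1 $ 3) \<and> Im (A $ 3 $ 1) = Im (A $ 1 $ 3) \<and>
    Re (A $ 3 $ 2) = - Re (A $ 2 $ 3) \<and> Im (A $ 3 $ 2) = Im (A $ 2 $ 3)"
  by (auto simp: su3_def cadj_def mtrace_def sum_3 entrywise)

text \<open>The signature of \<open>J21\<close> flips signs exactly in the relations coupling the
  third index to the other two.\<close>

lemma su21_iff:
  "A \<in> su21 \<longleftrightarrow>
    Re (A $ 1 $ 1) = 0 \<and> Re (A $ 2 $ 2) = 0 \<and> Re (A $ 3 $ 3) = 0 \<and>
    Im (A $ 3 $ 3) = - Im (A $ 1 $ 1) - Im (A $ 2 $ 2) \<and>
    Re (A $ 2 $ 1) = - Re (A $ 1 $ 2) \<and> Im (A $ 2 $ 1) = Im (A $ 1 $ 2) \<and>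
    Re (A $ 3 $ 1) = Re (A $ 1 $ 3) \<and> Im (A $ 3 $ 1) = - Im (A $ 1 $ 3) \<and>
    Re (A $ 3 $ 2) = Re (A $ 2 $ 3) \<and> Im (A $ 3 $ 2) = - Im (A $ 2 $ 3)"
  by (auto simp: su21_def cadj_def J21_def matrix_matrix_mult_def mtrace_def sum_3 entrywise)

text \<open>As a module over \<open>su(2)\<close>, the span of \<open>X\<^sub>4, \<dots>, X\<^sub>7\<close> is quaternionic, and the commuting
  element \<open>X\<^sub>8\<close> acts on it by an imaginary unit. The algebra \<open>L\<^sub>8\<^sub>,\<^sub>4\<^sup>0\<close> prescribes the unit sending
  \<open>X\<^sub>4\<close> to \<open>X\<^sub>6\<close>, while the invariant two-form in \<open>L\<^sub>8\<^sub>,\<^sub>2\<close> belongs to the one sending \<open>X\<^sub>4\<close> to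
  \<open>X\<^sub>5\<close> (up to sign); this accounts for the primed variants.\<close>

lemma su3_structure_su2:
  "has_structure_constants su3 commutator
    [(1, 2, 3, 1), (1, 3, 2, -1), (1, 4, 7, 1/2), (1, 5, 6, 1/2), (1, 6, 5, -1/2),
     (1, 7, 4, -1/2), (2, 3, 1, 1), (2, 4, 5, 1/2), (2, 5, 4, -1/2), (2, 6, 7, 1/2),
     (2, 7, 6, -1/2), (3, 4, 6, 1/2), (3, 5, 7, -1/2), (3, 6, 4, -1/2), (3, 7, 5, 1/2),
     (4, 5, 2, 2), (4, 6, 3, 2), (4, 6, 8, 3), (4, 7, 1, 2), (4, 8, 6, -1), (5, 6, 1, 2),
     (5, 7, 3, -2), (5, 7, 8, 3), (5, 8, 7, -1), (6, 7, 2, 2), (6, 8, 4, 1), (7, 8, 5, 1)]"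
  (is "has_structure_constants _ _ ?l")
proof (rule has_structure_constantsI)
  \<comment> \<open>The upper left block carries su(2) and the third column its module. The last
    coordinate multiplies diag(i, i, -2i)/3, so that \<open>X_8\<close> acts on that column as
    multiplication by i.\<close>
  let ?f = "\<lambda>x::real^8. vector
    [vector [Complex 0 (- x $ 2 / 2 + x $ 7 / 3),
       Complex (- x $ 1 / 2) (- x $ 0 / 2),
       Complex (x $ 6) (- x $ 4)],
     vector [Complex (x $ 1 / 2) (- x $ 0 / 2),
       Complex 0 (x $ 2 / 2 + x $ 7 / 3),
       Complex (- x $ 5) (x $ 3)],
     vector [Complex (- x $ 6) (- x $ 4), Complex (x $ 5) (x $ 3), Complex 0 (- 2 / 3 * x $ 7)]] :: complex^3^3"
  let ?g = "\<lambda>A::complex^3^3. vec8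
    (- 2 * Im (A $ 1 $ 2)) (- 2 * Re (A $ 1 $ 2)) (- Im (A $ 1 $ 1) + Im (A $ 2 $ 2))
    (Im (A $ 2 $ 3)) (- Im (A $ 1 $ 3)) (- Re (A $ 2 $ 3)) (Re (A $ 1 $ 3))
    (3 / 2 * Im (A $ 1 $ 1) + 3 / 2 * Im (A $ 2 $ 2))"
  show "linear ?f"
    by (rule linearI) (simp_all add: entrywise field_simps)
  show "linear ?g"
    by (rule linearI) (simp_all add: entrywise field_simps)
  show "?f x \<in> su3" for x
    by (simp add: su3_iff field_simps)
  show "?g (?f x) = x" for x
    by (simp add: entrywise field_simps)
  \<comment> \<open>\<open>?g\<close> reads only part of the upper triangle; membership in
    \<open>su3\<close> supplies the other entries.\<close>
  show "?f (?g A) = A" if "A \<in> su3" for A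
    using that by (simp add: su3_iff entrywise field_simps)
  show "commutator (?f x) (?f y) = ?f (sc_bracket ?l x y)" for x y
    by (simp add: commutator_nth sc_bracket_simps entrywise) (simp add: field_simps)
qed

lemma su3_structure_su2':
  "has_structure_constants su3 commutator
    [(1, 2, 3, 1), (1, 3, 2, -1), (1, 4, 7, 1/2), (1, 5, 6, 1/2), (1, 6, 5, -1/2),
     (1, 7, 4, -1/2), (2, 3, 1, 1), (2, 4, 5, 1/2), (2, 5, 4, -1/2), (2, 6, 7, 1/2),
     (2, 7, 6, -1/2), (3, 4, 6, 1/2), (3, 5, 7, -1/2), (3, 6, 4, -1/2), (3, 7, 5, 1/2),
     (4, 5, 2, 4), (4, 5, 8, -6), (4, 6, 3, 4), (4, 7, 1, 4), (4, 8, 5, 1), (5, 6, 1, 4),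
     (5, 7, 3, -4), (5, 8, 4, -1), (6, 7, 2, 4), (6, 7, 8, 6), (6, 8, 7, -1), (7, 8, 6, 1)]"
  (is "has_structure_constants _ _ ?l")
proof (rule has_structure_constantsI)
  \<comment> \<open>The new \<open>X_4\<close>, ..., \<open>X_7\<close> are images of the old ones
    under a map commuting with su(2). It stretches by sqrt 2, hence the doubled brackets inside the
    module.\<close>
  let ?f = "\<lambda>x::real^8. vector
    [vector [Complex 0 (- x $ 2 / 2 + x $ 7 / 3),
       Complex (- x $ 1 / 2) (- x $ 0 / 2),
       Complex (x $ 4 + x $ 5) (x $ 3 + x $ 6)],
     vector [Complex (x $ 1 / 2) (- x $ 0 / 2),
       Complex 0 (x $ 2 / 2 + x $ 7 / 3),
       Complex (- x $ 3 + x $ 6) (x $ 4 - x $ 5)],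
     vector [Complex (- x $ 4 - x $ 5) (x $ 3 + x $ 6),
       Complex (x $ 3 - x $ 6) (x $ 4 - x $ 5),
       Complex 0 (- 2 / 3 * x $ 7)]] :: complex^3^3"
  let ?g = "\<lambda>A::complex^3^3. vec8
    (- 2 * Im (A $ 1 $ 2)) (- 2 * Re (A $ 1 $ 2)) (- Im (A $ 1 $ 1) + Im (A $ 2 $ 2))
    (Im (A $ 1 $ 3) / 2 - Re (A $ 2 $ 3) / 2) (Re (A $ 1 $ 3) / 2 + Im (A $ 2 $ 3) / 2)
    (Re (A $ 1 $ 3) / 2 - Im (A $ 2 $ 3) / 2) (Im (A $ 1 $ 3) / 2 + Re (A $ 2 $ 3) / 2)
    (3 / 2 * Im (A $ 1 $ 1) + 3 / 2 * Im (A $ 2 $ 2))"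
  show "linear ?f"
    by (rule linearI) (simp_all add: entrywise field_simps)
  show "linear ?g"
    by (rule linearI) (simp_all add: entrywise field_simps)
  show "?f x \<in> su3" for x
    by (simp add: su3_iff field_simps)
  show "?g (?f x) = x" for x
    by (simp add: entrywise field_simps)
  show "?f (?g A) = A" if "A \<in> su3" for A
    using that by (simp add: su3_iff entrywise field_simps)
  show "commutator (?f x) (?f y) = ?f (sc_bracket ?l x y)" for x y
    by (simp add: commutator_nth sc_bracket_simps entrywise) (simp add: field_simps)
qed

text \<open>Noncompact dual of \<open>su3_structure_su2\<close>: changing the sign of the
  off-diagonal third row reverses the brackets among \<open>X_4\<close>, ..., \<open>X_7\<close> and
  no others.\<close>

lemma su21_structure_su2:
  "has_structure_constants su21 commutator
    [(1, 2, 3, 1), (1, 3, 2, -1), (1, 4, 7, 1/2), (1, 5, 6, 1/2), (1, 6, 5, -1/2),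
     (1, 7, 4, -1/2), (2, 3, 1, 1), (2, 4, 5, 1/2), (2, 5, 4, -1/2), (2, 6, 7, 1/2),
     (2, 7, 6, -1/2), (3, 4, 6, 1/2), (3, 5, 7, -1/2), (3, 6, 4, -1/2), (3, 7, 5, 1/2),
     (4, 5, 2, -2), (4, 6, 3, -2), (4, 6, 8, -3), (4, 7, 1, -2), (4, 8, 6, -1), (5, 6, 1, -2),
     (5, 7, 3, 2), (5, 7, 8, -3), (5, 8, 7, -1), (6, 7, 2, -2), (6, 8, 4, 1), (7, 8, 5, 1)]"
  (is "has_structure_constants _ _ ?l")
proof (rule has_structure_constantsI)
  let ?f = "\<lambda>x::real^8. vector
    [vector [Complex 0 (- x $ 2 / 2 + x $ 7 / 3),
       Complex (- x $ 1 / 2) (- x $ 0 / 2),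
       Complex (x $ 6) (- x $ 4)],
     vector [Complex (x $ 1 / 2) (- x $ 0 / 2),
       Complex 0 (x $ 2 / 2 + x $ 7 / 3),
       Complex (- x $ 5) (x $ 3)],
     vector [Complex (x $ 6) (x $ 4), Complex (- x $ 5) (- x $ 3), Complex 0 (- 2 / 3 * x $ 7)]] :: complex^3^3"
  let ?g = "\<lambda>A::complex^3^3. vec8
    (- 2 * Im (A $ 1 $ 2)) (- 2 * Re (A $ 1 $ 2)) (- Im (A $ 1 $ 1) + Im (A $ 2 $ 2))
    (Im (A $ 2 $ 3)) (- Im (A $ 1 $ 3)) (- Re (A $ 2 $ 3)) (Re (A $ 1 $ 3))
    (3 / 2 * Im (A $ 1 $ 1) + 3 / 2 * Im (A $ 2 $ 2))"
  show "linear ?f"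
    by (rule linearI) (simp_all add: entrywise field_simps)
  show "linear ?g"
    by (rule linearI) (simp_all add: entrywise field_simps)
  show "?f x \<in> su21" for x
    by (simp add: su21_iff field_simps)
  show "?g (?f x) = x" for x
    by (simp add: entrywise field_simps)
  show "?f (?g A) = A" if "A \<in> su21" for A
    using that by (simp add: su21_iff entrywise field_simps)
  show "commutator (?f x) (?f y) = ?f (sc_bracket ?l x y)" for x y
    by (simp add: commutator_nth sc_bracket_simps entrywise) (simp add: field_simps)
qed

lemma su21_structure_su2':
  "has_structure_constants su21 commutator
    [(1, 2, 3, 1), (1, 3, 2, -1), (1, 4, 7, 1/2), (1, 5, 6, 1/2), (1, 6, 5, -1/2),
     (1, 7, 4, -1/2), (2, 3, 1, 1), (2, 4, 5, 1/2), (2, 5, 4, -1/2), (2, 6, 7, 1/2),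
     (2, 7, 6, -1/2), (3, 4, 6, 1/2), (3, 5, 7, -1/2), (3, 6, 4, -1/2), (3, 7, 5, 1/2),
     (4, 5, 2, -4), (4, 5, 8, 6), (4, 6, 3, -4), (4, 7, 1, -4), (4, 8, 5, 1), (5, 6, 1, -4),
     (5, 7, 3, 4), (5, 8, 4, -1), (6, 7, 2, -4), (6, 7, 8, -6), (6, 8, 7, -1), (7, 8, 6, 1)]"
  (is "has_structure_constants _ _ ?l")
proof (rule has_structure_constantsI)
  let ?f = "\<lambda>x::real^8. vector
    [vector [Complex 0 (- x $ 2 / 2 + x $ 7 / 3),
       Complex (- x $ 1 / 2) (- x $ 0 / 2),
       Complex (x $ 4 + x $ 5) (x $ 3 + x $ 6)],
     vector [Complex (x $ 1 / 2) (- x $ 0 / 2),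
       Complex 0 (x $ 2 / 2 + x $ 7 / 3),
       Complex (- x $ 3 + x $ 6) (x $ 4 - x $ 5)],
     vector [Complex (x $ 4 + x $ 5) (- x $ 3 - x $ 6),
       Complex (- x $ 3 + x $ 6) (- x $ 4 + x $ 5),
       Complex 0 (- 2 / 3 * x $ 7)]] :: complex^3^3"
  let ?g = "\<lambda>A::complex^3^3. vec8
    (- 2 * Im (A $ 1 $ 2)) (- 2 * Re (A $ 1 $ 2)) (- Im (A $ 1 $ 1) + Im (A $ 2 $ 2))
    (Im (A $ 1 $ 3) / 2 - Re (A $ 2 $ 3) / 2) (Re (A $ 1 $ 3) / 2 + Im (A $ 2 $ 3) / 2)
    (Re (A $ 1 $ 3) / 2 - Im (A $ 2 $ 3) / 2) (Im (A $ 1 $ 3) / 2 + Re (A $ 2 $ 3) / 2)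
    (3 / 2 * Im (A $ 1 $ 1) + 3 / 2 * Im (A $ 2 $ 2))"
  show "linear ?f"
    by (rule linearI) (simp_all add: entrywise field_simps)
  show "linear ?g"
    by (rule linearI) (simp_all add: entrywise field_simps)
  show "?f x \<in> su21" for x
    by (simp add: su21_iff field_simps)
  show "?g (?f x) = x" for x
    by (simp add: entrywise field_simps)
  show "?f (?g A) = A" if "A \<in> su21" for A
    using that by (simp add: su21_iff entrywise field_simps)
  show "commutator (?f x) (?f y) = ?f (sc_bracket ?l x y)" for x y
    by (simp add: commutator_nth sc_bracket_simps entrywise) (simp add: field_simps)
qed

section \<open>Bases adapted to so(3)\<close>

lemma su3_structure_so3:
  "has_structure_constants su3 commutator
    [(1, 2, 3, 1), (1, 3, 2, -1), (1, 4, 7, 1/2), (1, 5, 6, -1/2), (1, 6, 5, 2), (1, 6, 8, -1),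
     (1, 7, 4, -2), (1, 8, 6, 3), (2, 3, 1, 1), (2, 4, 6, 1/2), (2, 5, 7, 1/2), (2, 6, 4, -2),
     (2, 7, 5, -2), (2, 7, 8, -1), (2, 8, 7, 3), (3, 4, 5, 2), (3, 5, 4, -2), (3, 6, 7, 1),
     (3, 7, 6, -1), (4, 5, 3, 1/8), (4, 6, 2, 1/8), (4, 7, 1, 1/8), (5, 6, 1, -1/8),
     (5, 7, 2, 1/8), (6, 7, 3, 1/4), (6, 8, 1, -3/4), (7, 8, 2, -3/4)]"
  (is "has_structure_constants _ _ ?l")
proof (rule has_structure_constantsI)
  \<comment> \<open>The real part is antisymmetric and gives so(3). The imaginary part is symmetric
    and traceless, the irreducible five-dimensional module.\<close>
  let ?f = "\<lambda>x::real^8. vector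
    [vector [Complex 0 (x $ 4 / 4 + x $ 7 / 2),
       Complex (- x $ 2) (- x $ 3 / 4),
       Complex (x $ 1) (- x $ 6 / 2)],
     vector [Complex (x $ 2) (- x $ 3 / 4),
       Complex 0 (- x $ 4 / 4 + x $ 7 / 2),
       Complex (- x $ 0) (x $ 5 / 2)],
     vector [Complex (- x $ 1) (- x $ 6 / 2), Complex (x $ 0) (x $ 5 / 2), Complex 0 (- x $ 7)]] :: complex^3^3"
  let ?g = "\<lambda>A::complex^3^3. vec8
    (- Re (A $ 2 $ 3)) (Re (A $ 1 $ 3)) (- Re (A $ 1 $ 2)) (- 4 * Im (A $ 1 $ 2))
    (2 * Im (A $ 1 $ 1) - 2 * Im (A $ 2 $ 2)) (2 * Im (A $ 2 $ 3)) (- 2 * Im (A $ 1 $ 3))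
    (Im (A $ 1 $ 1) + Im (A $ 2 $ 2))"
  show "linear ?f"
    by (rule linearI) (simp_all add: entrywise field_simps)
  show "linear ?g"
    by (rule linearI) (simp_all add: entrywise field_simps)
  show "?f x \<in> su3" for x
    by (simp add: su3_iff field_simps)
  show "?g (?f x) = x" for x
    by (simp add: entrywise field_simps)
  show "?f (?g A) = A" if "A \<in> su3" for A
    using that by (simp add: su3_iff entrywise field_simps)
  show "commutator (?f x) (?f y) = ?f (sc_bracket ?l x y)" for x y
    by (simp add: commutator_nth sc_bracket_simps entrywise) (simp add: field_simps)
qed

text \<open>Dropping the factor i from the symmetric part of \<open>su3_structure_so3\<close>
  reverses only the brackets of two complement vectors. These vanish in the limit, so both algebras
  reach the same target.\<close>

lemma sl3R_structure_so3:
  "has_structure_constants sl3R commutator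
    [(1, 2, 3, 1), (1, 3, 2, -1), (1, 4, 7, 1/2), (1, 5, 6, -1/2), (1, 6, 5, 2), (1, 6, 8, -1),
     (1, 7, 4, -2), (1, 8, 6, 3), (2, 3, 1, 1), (2, 4, 6, 1/2), (2, 5, 7, 1/2), (2, 6, 4, -2),
     (2, 7, 5, -2), (2, 7, 8, -1), (2, 8, 7, 3), (3, 4, 5, 2), (3, 5, 4, -2), (3, 6, 7, 1),
     (3, 7, 6, -1), (4, 5, 3, -1/8), (4, 6, 2, -1/8), (4, 7, 1, -1/8), (5, 6, 1, 1/8),
     (5, 7, 2, -1/8), (6, 7, 3, -1/4), (6, 8, 1, 3/4), (7, 8, 2, 3/4)]"
  (is "has_structure_constants _ _ ?l")
proof (rule has_structure_constantsI)
  let ?f = "\<lambda>x::real^8. vector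
    [vector [x $ 4 / 4 + x $ 7 / 2, - x $ 2 - x $ 3 / 4, x $ 1 - x $ 6 / 2],
     vector [x $ 2 - x $ 3 / 4, - x $ 4 / 4 + x $ 7 / 2, - x $ 0 + x $ 5 / 2],
     vector [- x $ 1 - x $ 6 / 2, x $ 0 + x $ 5 / 2, - x $ 7]] :: real^3^3"
  let ?g = "\<lambda>A::real^3^3. vec8
    (- A $ 2 $ 3 / 2 + A $ 3 $ 2 / 2) (A $ 1 $ 3 / 2 - A $ 3 $ 1 / 2)
    (- A $ 1 $ 2 / 2 + A $ 2 $ 1 / 2) (- 2 * A $ 1 $ 2 - 2 * A $ 2 $ 1)
    (2 * A $ 1 $ 1 - 2 * A $ 2 $ 2) (A $ 2 $ 3 + A $ 3 $ 2) (- A $ 1 $ 3 - A $ 3 $ 1)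
    (A $ 1 $ 1 + A $ 2 $ 2)"
  show "linear ?f"
    by (rule linearI) (simp_all add: entrywise field_simps)
  show "linear ?g"
    by (rule linearI) (simp_all add: entrywise field_simps)
  show "?f x \<in> sl3R" for x
    by (simp add: sl3R_iff field_simps)
  show "?g (?f x) = x" for x
    by (simp add: entrywise field_simps)
  show "?f (?g A) = A" if "A \<in> sl3R" for A
    using that by (simp add: sl3R_iff entrywise field_simps)
  show "commutator (?f x) (?f y) = ?f (sc_bracket ?l x y)" for x y
    by (simp add: commutator_nth sc_bracket_simps entrywise) (simp add: field_simps)
qed

section \<open>Bases adapted to sl(2)\<close>

lemma su21_structure_su11:
  "has_structure_constants su21 commutator
    [(1, 2, 2, 2), (1, 3, 3, -2), (1, 4, 4, 1), (1, 5, 5, -1), (1, 6, 6, 1), (1, 7, 7, -1),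
     (2, 3, 1, 1), (2, 5, 4, 1), (2, 7, 6, 1), (3, 4, 5, 1), (3, 6, 7, 1), (4, 5, 8, -6),
     (4, 6, 2, 4), (4, 7, 1, -2), (4, 8, 6, -1), (5, 6, 1, -2), (5, 7, 3, -4), (5, 8, 7, -1),
     (6, 7, 8, -6), (6, 8, 4, 1), (7, 8, 5, 1)]"
  (is "has_structure_constants _ _ ?l")
proof (rule has_structure_constantsI)
  \<comment> \<open>Coordinates 2 and 3 span a plane of signature (1,1), so their block carries
    su(1,1), isomorphic to sl(2), with \<open>X_2\<close> and \<open>X_3\<close> nilpotent. On the
    remaining module \<open>X_8\<close> acts as a complex structure pairing \<open>X_4\<close> with
    \<open>X_6\<close> and \<open>X_5\<close> with \<open>X_7\<close>.\<close>
  let ?f = "\<lambda>x::real^8. vector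
    [vector [Complex 0 (- 2 / 3 * x $ 7),
       Complex (x $ 3 + x $ 6) (x $ 4 - x $ 5),
       Complex (- x $ 3 + x $ 6) (x $ 4 + x $ 5)],
     vector [Complex (- x $ 3 - x $ 6) (x $ 4 - x $ 5),
       Complex 0 (x $ 1 / 2 - x $ 2 / 2 + x $ 7 / 3),
       Complex (x $ 0) (- x $ 1 / 2 - x $ 2 / 2)],
     vector [Complex (- x $ 3 + x $ 6) (- x $ 4 - x $ 5),
       Complex (x $ 0) (x $ 1 / 2 + x $ 2 / 2),
       Complex 0 (- x $ 1 / 2 + x $ 2 / 2 + x $ 7 / 3)]] :: complex^3^3"
  let ?g = "\<lambda>A::complex^3^3. vec8
    (Re (A $ 2 $ 3)) (Im (A $ 1 $ 1) / 2 + Im (A $ 2 $ 2) - Im (A $ 2 $ 3))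
    (- Im (A $ 1 $ 1) / 2 - Im (A $ 2 $ 2) - Im (A $ 2 $ 3))
    (Re (A $ 1 $ 2) / 2 - Re (A $ 1 $ 3) / 2) (Im (A $ 1 $ 2) / 2 + Im (A $ 1 $ 3) / 2)
    (- Im (A $ 1 $ 2) / 2 + Im (A $ 1 $ 3) / 2) (Re (A $ 1 $ 2) / 2 + Re (A $ 1 $ 3) / 2)
    (- 3 / 2 * Im (A $ 1 $ 1))"
  show "linear ?f"
    by (rule linearI) (simp_all add: entrywise field_simps)
  show "linear ?g"
    by (rule linearI) (simp_all add: entrywise field_simps)
  show "?f x \<in> su21" for x
    by (simp add: su21_iff field_simps)
  show "?g (?f x) = x" for x
    by (simp add: entrywise field_simps)
  show "?f (?g A) = A" if "A \<in> su21" for A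
    using that by (simp add: su21_iff entrywise field_simps)
  show "commutator (?f x) (?f y) = ?f (sc_bracket ?l x y)" for x y
    by (simp add: commutator_nth sc_bracket_simps entrywise) (simp add: field_simps)
qed

text \<open>On the span of \<open>X\<^sub>4, \<dots>, X\<^sub>7\<close> the element \<open>X\<^sub>8\<close> is diagonal in the first basis, as in
  \<open>L\<^sub>8\<^sub>,\<^sub>1\<^sub>7\<close>. In the second one it exchanges the two copies of the standard module of \<open>sl(2)\<close>; this
  diagonalises the two-form of \<open>L\<^sub>8\<^sub>,\<^sub>1\<^sub>3\<close>, and giving the two copies different weights leaves the
  nilpotent action of \<open>X\<^sub>8\<close> in \<open>L\<^sub>8\<^sub>,\<^sub>1\<^sub>4\<close> and \<open>L\<^sub>8\<^sub>,\<^sub>1\<^sub>5\<close>.\<close>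

lemma sl3R_structure_sl2:
  "has_structure_constants sl3R commutator
    [(1, 2, 2, 2), (1, 3, 3, -2), (1, 4, 4, 1), (1, 5, 5, -1), (1, 6, 6, 1), (1, 7, 7, -1),
     (2, 3, 1, 1), (2, 5, 4, 1), (2, 7, 6, 1), (3, 4, 5, 1), (3, 6, 7, 1), (4, 6, 2, -1),
     (4, 7, 1, 1/2), (4, 7, 8, -3/2), (4, 8, 4, 1), (5, 6, 1, 1/2), (5, 6, 8, 3/2), (5, 7, 3, 1),
     (5, 8, 5, 1), (6, 8, 6, -1), (7, 8, 7, -1)]"
  (is "has_structure_constants _ _ ?l")
proof (rule has_structure_constantsI)
  let ?f = "\<lambda>x::real^8. vector
    [vector [x $ 0 - x $ 7 / 3, x $ 1, x $ 3],
     vector [x $ 2, - x $ 0 - x $ 7 / 3, x $ 4],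
     vector [x $ 6, - x $ 5, 2 / 3 * x $ 7]] :: real^3^3"
  let ?g = "\<lambda>A::real^3^3. vec8
    (A $ 1 $ 1 / 2 - A $ 2 $ 2 / 2) (A $ 1 $ 2) (A $ 2 $ 1) (A $ 1 $ 3) (A $ 2 $ 3) (- A $ 3 $ 2)
    (A $ 3 $ 1) (- 3 / 2 * A $ 1 $ 1 - 3 / 2 * A $ 2 $ 2)"
  show "linear ?f"
    by (rule linearI) (simp_all add: entrywise field_simps)
  show "linear ?g"
    by (rule linearI) (simp_all add: entrywise field_simps)
  show "?f x \<in> sl3R" for x
    by (simp add: sl3R_iff field_simps)
  show "?g (?f x) = x" for x
    by (simp add: entrywise field_simps)
  show "?f (?g A) = A" if "A \<in> sl3R" for A
    using that by (simp add: sl3R_iff entrywise field_simps)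
  show "commutator (?f x) (?f y) = ?f (sc_bracket ?l x y)" for x y
    by (simp add: commutator_nth sc_bracket_simps entrywise) (simp add: field_simps)
qed

lemma sl3R_structure_sl2':
  "has_structure_constants sl3R commutator
    [(1, 2, 2, 2), (1, 3, 3, -2), (1, 4, 4, 1), (1, 5, 5, -1), (1, 6, 6, 1), (1, 7, 7, -1),
     (2, 3, 1, 1), (2, 5, 4, 1), (2, 7, 6, 1), (3, 4, 5, 1), (3, 6, 7, 1), (4, 5, 8, 3),
     (4, 6, 2, -2), (4, 7, 1, 1), (4, 8, 6, 1), (5, 6, 1, 1), (5, 7, 3, 2), (5, 8, 7, 1),
     (6, 7, 8, -3), (6, 8, 4, 1), (7, 8, 5, 1)]"
  (is "has_structure_constants _ _ ?l")
proof (rule has_structure_constantsI)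
  \<comment> \<open>\<open>X_4\<close>, \<open>X_5\<close> are differences and \<open>X_6\<close>,
    \<open>X_7\<close> sums of corresponding vectors of the two eigenspaces of \<open>X_8\<close> in
    the previous basis.\<close>
  let ?f = "\<lambda>x::real^8. vector
    [vector [x $ 0 - x $ 7 / 3, x $ 1, x $ 3 + x $ 5],
     vector [x $ 2, - x $ 0 - x $ 7 / 3, x $ 4 + x $ 6],
     vector [- x $ 4 + x $ 6, x $ 3 - x $ 5, 2 / 3 * x $ 7]] :: real^3^3"
  let ?g = "\<lambda>A::real^3^3. vec8
    (A $ 1 $ 1 / 2 - A $ 2 $ 2 / 2) (A $ 1 $ 2) (A $ 2 $ 1) (A $ 1 $ 3 / 2 + A $ 3 $ 2 / 2)
    (A $ 2 $ 3 / 2 - A $ 3 $ 1 / 2) (A $ 1 $ 3 / 2 - A $ 3 $ 2 / 2)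
    (A $ 2 $ 3 / 2 + A $ 3 $ 1 / 2) (- 3 / 2 * A $ 1 $ 1 - 3 / 2 * A $ 2 $ 2)"
  show "linear ?f"
    by (rule linearI) (simp_all add: entrywise field_simps)
  show "linear ?g"
    by (rule linearI) (simp_all add: entrywise field_simps)
  show "?f x \<in> sl3R" for x
    by (simp add: sl3R_iff field_simps)
  show "?g (?f x) = x" for x
    by (simp add: entrywise field_simps)
  show "?f (?g A) = A" if "A \<in> sl3R" for A
    using that by (simp add: sl3R_iff entrywise field_simps)
  show "commutator (?f x) (?f y) = ?f (sc_bracket ?l x y)" for x y
    by (simp add: commutator_nth sc_bracket_simps entrywise) (simp add: field_simps)
qed

section \<open>Bases adapted to so(2,1)\<close>

lemma su21_structure_so21:
  "has_structure_constants su21 commutator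
    [(1, 2, 2, 2), (1, 3, 3, -2), (1, 4, 4, 4), (1, 5, 5, 2), (1, 7, 7, -2), (1, 8, 8, -4),
     (2, 3, 1, 1), (2, 5, 4, 4), (2, 6, 5, 3), (2, 7, 6, 2), (2, 8, 7, 1), (3, 4, 5, 1),
     (3, 5, 6, 2), (3, 6, 7, 3), (3, 7, 8, 4), (4, 7, 2, 4), (4, 8, 1, -2), (5, 6, 2, -12),
     (5, 7, 1, 4), (5, 8, 3, -4), (6, 7, 3, 12)]"
  (is "has_structure_constants _ _ ?l")
proof (rule has_structure_constantsI)
  \<comment> \<open>The real matrices in su(2,1) form so(2,1). The imaginary ones form an
    irreducible module with weights 4, 2, 0, -2, -4 under \<open>X_1\<close>.\<close>
  let ?f = "\<lambda>x::real^8. vector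
    [vector [Complex 0 (4 * x $ 5),
       Complex (x $ 1 - x $ 2) (- 2 * x $ 4 + 2 * x $ 6),
       Complex (- x $ 1 - x $ 2) (2 * x $ 4 + 2 * x $ 6)],
     vector [Complex (- x $ 1 + x $ 2) (- 2 * x $ 4 + 2 * x $ 6),
       Complex 0 (x $ 3 - 2 * x $ 5 + x $ 7),
       Complex (2 * x $ 0) (- x $ 3 + x $ 7)],
     vector [Complex (- x $ 1 - x $ 2) (- 2 * x $ 4 - 2 * x $ 6),
       Complex (2 * x $ 0) (x $ 3 - x $ 7),
       Complex 0 (- x $ 3 - 2 * x $ 5 - x $ 7)]] :: complex^3^3"
  let ?g = "\<lambda>A::complex^3^3. vec8
    (Re (A $ 2 $ 3) / 2) (Re (A $ 1 $ 2) / 2 - Re (A $ 1 $ 3) / 2)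
    (- Re (A $ 1 $ 2) / 2 - Re (A $ 1 $ 3) / 2)
    (Im (A $ 1 $ 1) / 4 + Im (A $ 2 $ 2) / 2 - Im (A $ 2 $ 3) / 2)
    (- Im (A $ 1 $ 2) / 4 + Im (A $ 1 $ 3) / 4) (Im (A $ 1 $ 1) / 4)
    (Im (A $ 1 $ 2) / 4 + Im (A $ 1 $ 3) / 4)
    (Im (A $ 1 $ 1) / 4 + Im (A $ 2 $ 2) / 2 + Im (A $ 2 $ 3) / 2)"
  show "linear ?f"
    by (rule linearI) (simp_all add: entrywise field_simps)
  show "linear ?g"
    by (rule linearI) (simp_all add: entrywise field_simps)
  show "?f x \<in> su21" for x
    by (simp add: su21_iff field_simps)
  show "?g (?f x) = x" for x
    by (simp add: entrywise field_simps)
  show "?f (?g A) = A" if "A \<in> su21" for A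
    using that by (simp add: su21_iff entrywise field_simps)
  show "commutator (?f x) (?f y) = ?f (sc_bracket ?l x y)" for x y
    by (simp add: commutator_nth sc_bracket_simps entrywise) (simp add: field_simps)
qed

text \<open>This is the principal sl(2), and \<open>X_4\<close> is the highest weight vector of its
  complement. Complement brackets are -1/4 times those of \<open>su21_structure_so21\<close> and
  vanish in the limit.\<close>

lemma sl3R_structure_so21:
  "has_structure_constants sl3R commutator
    [(1, 2, 2, 2), (1, 3, 3, -2), (1, 4, 4, 4), (1, 5, 5, 2), (1, 7, 7, -2), (1, 8, 8, -4),
     (2, 3, 1, 1), (2, 5, 4, 4), (2, 6, 5, 3), (2, 7, 6, 2), (2, 8, 7, 1), (3, 4, 5, 1),
     (3, 5, 6, 2), (3, 6, 7, 3), (3, 7, 8, 4), (4, 7, 2, -1), (4, 8, 1, 1/2), (5, 6, 2, 3),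
     (5, 7, 1, -1), (5, 8, 3, 1), (6, 7, 3, -3)]"
  (is "has_structure_constants _ _ ?l")
proof (rule has_structure_constantsI)
  let ?f = "\<lambda>x::real^8. vector
    [vector [2 * x $ 0 + x $ 5, 2 * x $ 1 - 2 * x $ 4, x $ 3],
     vector [x $ 2 + x $ 6, - 2 * x $ 5, x $ 1 + x $ 4],
     vector [x $ 7, 2 * x $ 2 - 2 * x $ 6, - 2 * x $ 0 + x $ 5]] :: real^3^3"
  let ?g = "\<lambda>A::real^3^3. vec8
    (A $ 1 $ 1 / 2 + A $ 2 $ 2 / 4) (A $ 1 $ 2 / 4 + A $ 2 $ 3 / 2)
    (A $ 2 $ 1 / 2 + A $ 3 $ 2 / 4) (A $ 1 $ 3) (- A $ 1 $ 2 / 4 + A $ 2 $ 3 / 2)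
    (- A $ 2 $ 2 / 2) (A $ 2 $ 1 / 2 - A $ 3 $ 2 / 4) (A $ 3 $ 1)"
  show "linear ?f"
    by (rule linearI) (simp_all add: entrywise field_simps)
  show "linear ?g"
    by (rule linearI) (simp_all add: entrywise field_simps)
  show "?f x \<in> sl3R" for x
    by (simp add: sl3R_iff field_simps)
  show "?g (?f x) = x" for x
    by (simp add: entrywise field_simps)
  show "?f (?g A) = A" if "A \<in> sl3R" for A
    using that by (simp add: sl3R_iff entrywise field_simps)
  show "commutator (?f x) (?f y) = ?f (sc_bracket ?l x y)" for x y
    by (simp add: commutator_nth sc_bracket_simps entrywise) (simp add: field_simps)
qed

section \<open>The contractions\<close>

lemma su3_contracts_onto_L8_2: "contracts_onto su3 commutator UNIV L8_2"
  by (rule contracts_onto_if_limit_constants[OF su3_structure_su2',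
        \<comment> \<open>Weight 2 keeps the \<open>X_8\<close> part of brackets of weight-1 vectors
          and kills the action of \<open>X_8\<close> on them. \<open>d 8\<close> normalises the
          constant -6 to 1.\<close>
        where n = "\<lambda>i. if i < 4 then 0 else if i < 8 then 1 else 2"
          and d = "\<lambda>i. if i = 8 then -6 else 1"])
    \<comment> \<open>The lists differ in order and vanished entries remain, so the brackets are
      expanded and compared as sums.\<close>
    (simp_all add: valid_weights_def limit_constants_def sc_bracket_Cons sc_bracket_Nil algebra_simps
      L8_2_def listA_def)

lemma su3_contracts_onto_L8_4_0: "contracts_onto su3 commutator UNIV L8_4_0"
  by (rule contracts_onto_if_limit_constants[OF su3_structure_su2,
        \<comment> \<open>Weight 0 keeps the action of \<open>X_8\<close>, while \<open>X_4\<close>,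
          ..., \<open>X_7\<close> become abelian.\<close>
        where n = "\<lambda>i. if 4 \<le> i \<and> i < 8 then 1 else 0"
          and d = "\<lambda>i. 1"])
    (simp_all add: valid_weights_def limit_constants_def sc_bracket_Cons sc_bracket_Nil algebra_simps
      L8_4_0_def listA_def)

lemma su3_contracts_onto_L8_5: "contracts_onto su3 commutator UNIV L8_5"
  by (rule contracts_onto_if_limit_constants[OF su3_structure_so3,
        \<comment> \<open>Contraction along a symmetric pair: so(3) stays, its complement becomes
          abelian.\<close>
        where n = "\<lambda>i. if i < 4 then 0 else 1"
          and d = "\<lambda>i. 1"])
    (simp_all add: valid_weights_def limit_constants_def sc_bracket_Cons sc_bracket_Nil algebra_simps
      L8_5_def)

section \<open>Contractions of su(2,1)\<close>

lemma su21_contracts_onto_L8_2: "contracts_onto su21 commutator UNIV L8_2"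
  by (rule contracts_onto_if_limit_constants[OF su21_structure_su2',
        where n = "\<lambda>i. if i < 4 then 0 else if i < 8 then 1 else 2"
          and d = "\<lambda>i. if i = 8 then 6 else 1"])
    (simp_all add: valid_weights_def limit_constants_def sc_bracket_Cons sc_bracket_Nil algebra_simps
      L8_2_def listA_def)

lemma su21_contracts_onto_L8_4_0: "contracts_onto su21 commutator UNIV L8_4_0"
  by (rule contracts_onto_if_limit_constants[OF su21_structure_su2,
        where n = "\<lambda>i. if 4 \<le> i \<and> i < 8 then 1 else 0"
          and d = "\<lambda>i. 1"])
    (simp_all add: valid_weights_def limit_constants_def sc_bracket_Cons sc_bracket_Nil algebra_simps
      L8_4_0_def listA_def)

lemma su21_contracts_onto_L8_13: "contracts_onto su21 commutator UNIV (L8_13 1)"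
  by (rule contracts_onto_if_limit_constants[OF su21_structure_su11,
        where n = "\<lambda>i. if i < 4 then 0 else if i < 8 then 1 else 2"
          and d = "\<lambda>i. if i = 8 then -6 else 1"])
    (simp_all add: valid_weights_def limit_constants_def sc_bracket_Cons sc_bracket_Nil algebra_simps
      L8_13_def listB_def)

lemma su21_contracts_onto_L8_14: "contracts_onto su21 commutator UNIV L8_14"
  by (rule contracts_onto_if_limit_constants[OF su21_structure_su11,
        \<comment> \<open>Since 2 = 1 + 1, \<open>X_8\<close> still maps \<open>X_6\<close>,
          \<open>X_7\<close> to \<open>X_4\<close>, \<open>X_5\<close>; the reverse map dies and the
          action becomes nilpotent.\<close>
        where n = "\<lambda>i. if i < 4 then 0 else if i < 6 then 2 else 1"
          and d = "\<lambda>i. 1"])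
    (simp_all add: valid_weights_def limit_constants_def sc_bracket_Cons sc_bracket_Nil algebra_simps
      L8_14_def listB_def)

lemma su21_contracts_onto_L8_15: "contracts_onto su21 commutator UNIV L8_15"
  by (rule contracts_onto_if_limit_constants[OF su21_structure_su11,
        \<comment> \<open>Here 2 = 1 + 1 and 3 = 1 + 2: both the bracket of \<open>X_6\<close> with
          \<open>X_7\<close> and the nilpotent action survive. Scaling \<open>X_4\<close>,
          \<open>X_5\<close> along with \<open>X_8\<close> keeps the constants of that action at
          1.\<close>
        where n = "\<lambda>i. if i < 4 then 0 else if i < 6 then 3 else if i < 8 then 1 else 2"
          and d = "\<lambda>i. if i \<in> {4, 5, 8} then -6 else 1"])
    (simp_all add: valid_weights_def limit_constants_def sc_bracket_Cons sc_bracket_Nil algebra_simps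
      L8_15_def listB_def)

lemma su21_contracts_onto_L8_18_0: "contracts_onto su21 commutator UNIV L8_18_0"
  by (rule contracts_onto_if_limit_constants[OF su21_structure_su11,
        where n = "\<lambda>i. if 4 \<le> i \<and> i < 8 then 1 else 0"
          and d = "\<lambda>i. 1"])
    (simp_all add: valid_weights_def limit_constants_def sc_bracket_Cons sc_bracket_Nil algebra_simps
      L8_18_0_def listB_def)

lemma su21_contracts_onto_L8_21: "contracts_onto su21 commutator UNIV L8_21"
  by (rule contracts_onto_if_limit_constants[OF su21_structure_so21,
        where n = "\<lambda>i. if i < 4 then 0 else 1"
          and d = "\<lambda>i. 1"])
    (simp_all add: valid_weights_def limit_constants_def sc_bracket_Cons sc_bracket_Nil algebra_simps
      L8_21_def)

section \<open>Contractions of sl(3,R)\<close>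

lemma sl3R_contracts_onto_L8_5: "contracts_onto sl3R commutator UNIV L8_5"
  by (rule contracts_onto_if_limit_constants[OF sl3R_structure_so3,
        where n = "\<lambda>i. if i < 4 then 0 else 1"
          and d = "\<lambda>i. 1"])
    (simp_all add: valid_weights_def limit_constants_def sc_bracket_Cons sc_bracket_Nil algebra_simps
      L8_5_def)

lemma sl3R_contracts_onto_L8_13: "contracts_onto sl3R commutator UNIV (L8_13 (-1))"
  by (rule contracts_onto_if_limit_constants[OF sl3R_structure_sl2',
        \<comment> \<open>The constants 3 and -3 leading to \<open>X_8\<close> have opposite signs,
          which no choice of \<open>d 8\<close> alone can change; hence the parameter -1.\<close>
        where n = "\<lambda>i. if i < 4 then 0 else if i < 8 then 1 else 2"
          and d = "\<lambda>i. if i = 8 then 3 else 1"])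
    (simp_all add: valid_weights_def limit_constants_def sc_bracket_Cons sc_bracket_Nil algebra_simps
      L8_13_def listB_def)

lemma sl3R_contracts_onto_L8_14: "contracts_onto sl3R commutator UNIV L8_14"
  by (rule contracts_onto_if_limit_constants[OF sl3R_structure_sl2',
        where n = "\<lambda>i. if i < 4 then 0 else if i < 6 then 2 else 1"
          and d = "\<lambda>i. 1"])
    (simp_all add: valid_weights_def limit_constants_def sc_bracket_Cons sc_bracket_Nil algebra_simps
      L8_14_def listB_def)

lemma sl3R_contracts_onto_L8_15: "contracts_onto sl3R commutator UNIV L8_15"
  by (rule contracts_onto_if_limit_constants[OF sl3R_structure_sl2',
        where n = "\<lambda>i. if i < 4 then 0 else if i < 6 then 3 else if i < 8 then 1 else 2"
          and d = "\<lambda>i. if i \<in> {4, 5, 8} then -3 else 1"])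
    (simp_all add: valid_weights_def limit_constants_def sc_bracket_Cons sc_bracket_Nil algebra_simps
      L8_15_def listB_def)

lemma sl3R_contracts_onto_L8_17_m1: "contracts_onto sl3R commutator UNIV L8_17_m1"
  by (rule contracts_onto_if_limit_constants[OF sl3R_structure_sl2,
        where n = "\<lambda>i. if 4 \<le> i \<and> i < 8 then 1 else 0"
          and d = "\<lambda>i. 1"])
    (simp_all add: valid_weights_def limit_constants_def sc_bracket_Cons sc_bracket_Nil algebra_simps
      L8_17_m1_def listB_def)

lemma sl3R_contracts_onto_L8_21: "contracts_onto sl3R commutator UNIV L8_21"
  by (rule contracts_onto_if_limit_constants[OF sl3R_structure_so21,
        where n = "\<lambda>i. if i < 4 then 0 else 1"
          and d = "\<lambda>i. 1"])
    (simp_all add: valid_weights_def limit_constants_def sc_bracket_Cons sc_bracket_Nil algebra_simps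
      L8_21_def)

theorem theorem2:
  shows
   "contracts_onto su3 commutator UNIV L8_2 \<and>
    contracts_onto su3 commutator UNIV L8_4_0 \<and>
    contracts_onto su3 commutator UNIV L8_5 \<and>
    contracts_onto su21 commutator UNIV L8_2 \<and>
    contracts_onto su21 commutator UNIV L8_4_0 \<and>
    contracts_onto su21 commutator UNIV (L8_13 1) \<and>
    contracts_onto su21 commutator UNIV L8_14 \<and>
    contracts_onto su21 commutator UNIV L8_15 \<and>
    contracts_onto su21 commutator UNIV L8_18_0 \<and>
    contracts_onto su21 commutator UNIV L8_21 \<and>
    contracts_onto sl3R commutator UNIV L8_5 \<and>
    contracts_onto sl3R commutator UNIV (L8_13 (-1)) \<and>
    contracts_onto sl3R commutator UNIV L8_14 \<and>
    contracts_onto sl3R commutator UNIV L8_15 \<and>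
    contracts_onto sl3R commutator UNIV L8_17_m1 \<and>
    contracts_onto sl3R commutator UNIV L8_21"
  by (intro conjI su3_contracts_onto_L8_2
      su3_contracts_onto_L8_4_0
      su3_contracts_onto_L8_5
      su21_contracts_onto_L8_2
      su21_contracts_onto_L8_4_0
      su21_contracts_onto_L8_13
      su21_contracts_onto_L8_14
      su21_contracts_onto_L8_15
      su21_contracts_onto_L8_18_0
      su21_contracts_onto_L8_21
      sl3R_contracts_onto_L8_5
      sl3R_contracts_onto_L8_13
      sl3R_contracts_onto_L8_14
      sl3R_contracts_onto_L8_15
      sl3R_contracts_onto_L8_17_m1
      sl3R_contracts_onto_L8_21)

end
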